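(* Let $(\mathcal{A},\varphi)$ be a non-commutative probability space, let $a\in\mathcal{A}$ be a selfadjoint random variable, and let $\xi\in\mathcal{A}$ be a conjugate variable for $a$, i.e. $\varphi(\xi\,p(a))=(\varphi\otimes\varphi)(\partial p(a))$ for all polynomials $p\in\mathbb{C}\langle x\rangle$. For $p,q\in\mathbb{C}\langle x\rangle$ put $$\varphi_1(p(x)):=\varphi(p(a)),\qquad \varphi_2(p(x),q(x)):=\kappa_2(p(a),q(a)),\qquad \varphi_2(\xi p(x),q(x)):=\kappa_2(\xi p(a),q(a)).$$ Then for all $p,q\in\mathbb{C}\langle x\rangle$, $$\varphi_2\bigl(\xi p(x),q(x)\bigr)=\varphi_2\bigl((\varphi_1\otimes\mathrm{id})(\partial p(x)),\,q(x)\bigr)+(\varphi_1\otimes\varphi_1)\bigl((p(x)\otimes 1)\cdot\partial q(x)\bigr).$$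
   Context: $\mathbb{C}\langle x\rangle$ denotes the algebra of complex polynomials in one variable $x$. The non-commutative derivative is the linear map $\partial:\mathbb{C}\langle x\rangle\to\mathbb{C}\langle x\rangle\otimes\mathbb{C}\langle x\rangle$ with $\partial x^n=\sum_{k=0}^{n-1}x^k\otimes x^{n-k-1}$ (so $\partial 1=0$). $\partial p(a)$ denotes the element of $\mathcal{A}\otimes\mathcal{A}$ obtained by substituting $a$ for $x$ in both tensor factors of $\partial p$. The product in $\mathbb{C}\langle x\rangle\otimes\mathbb{C}\langle x\rangle$ is $(f\otimes g)\cdot(f'\otimes g')=ff'\otimes gg'$. Further, $(\varphi_1\otimes\mathrm{id})(f\otimes g)=\varphi_1(f)\,g$ and $(\varphi_1\otimes\varphi_1)(f\otimes g)=\varphi_1(f)\varphi_1(g)$, and similarly for $\varphi\otimes\varphi$. A non-commutative probability space $(\mathcal{A},\varphi)$ is a unital complex algebra with a unital linear functional; $\kappa_2(b,c)=\varphi(bc)-\varphi(b)\varphi(c)$ is the second free cumulant. Background for the notation: $\varphi_1$ and $\varphi_2$ arise as $\varphi_1(p)=\lim_{N\to\infty}\kappa_1(\mathrm{tr}(p(A)))$ and $\varphi_2(p,q)=\lim_{N\to\infty}\kappa_2(\mathrm{Tr}(p(A)),\mathrm{Tr}(q(A)))$, where $\mathrm{Tr}$ is the unnormalized trace, $\mathrm{tr}=\frac1N\mathrm{Tr}$, and $A=(a_{ij})_{i,j=1}^N$ is the $N\times N$ matrix with non-commutative entries whose free cumulants are $\kappa_n(a_{i(1)i(2)},\dots,a_{i(n)i(1)})=N^{-(n-1)}\kappa_n(a,\dots,a)$,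 all other free cumulants of the entries being zero; these limits equal $\varphi(p(a))$ and $\kappa_2(p(a),q(a))$ respectively. *)

theory Defs
  imports
    Complex_Main
    "HOL-Library.Poly_Mapping"
    "HOL-Computational_Algebra.Polynomial"
begin

section \<open>Complex vector spaces and complex algebras\<close>

class scaleC =
  fixes scaleC :: "complex \<Rightarrow> 'a \<Rightarrow> 'a"  (infixr "*\<^sub>C" 75)

class complex_vector = ab_group_add + scaleC +
  assumes scaleC_add_right: "c *\<^sub>C (x + y) = c *\<^sub>C x + c *\<^sub>C y"
    and scaleC_add_left: "(c + d) *\<^sub>C x = c *\<^sub>C x + d *\<^sub>C x"
    and scaleC_scaleC [simp]: "c *\<^sub>C d *\<^sub>C x = (c * d) *\<^sub>C x"
    and scaleC_one [simp]: "1 *\<^sub>C x = x"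

global_interpretation complex_vector: vector_space "scaleC :: complex \<Rightarrow> 'a \<Rightarrow> 'a::complex_vector"
  defines cspan_raw_def: cspan = complex_vector.span
  by unfold_locales (simp_all add: scaleC_add_right scaleC_add_left)

abbreviation clinear :: "('a::complex_vector \<Rightarrow> 'b::complex_vector) \<Rightarrow> bool"
  where "clinear \<equiv> Vector_Spaces.linear scaleC scaleC"

definition cbilinear :: "('a::complex_vector \<Rightarrow> 'b::complex_vector \<Rightarrow> 'c::complex_vector) \<Rightarrow> bool"
  where "cbilinear B \<longleftrightarrow> (\<forall>x. clinear (B x)) \<and> (\<forall>y. clinear (\<lambda>x. B x y))"

class complex_algebra = ring + complex_vector +
  assumes mult_scaleC_left [simp]: "(c *\<^sub>C x) * y = c *\<^sub>C (x * y)"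
    and mult_scaleC_right [simp]: "x * (c *\<^sub>C y) = c *\<^sub>C (x * y)"

class complex_algebra_1 = complex_algebra + ring_1

class complex_star_algebra_1 = complex_algebra_1 +
  fixes star :: "'a \<Rightarrow> 'a"
  assumes star_star: "star (star x) = x"
    and star_add: "star (x + y) = star x + star y"
    and star_scaleC: "star (c *\<^sub>C x) = cnj c *\<^sub>C star x"
    and star_mult: "star (x * y) = star y * star x"

definition selfadjoint :: "'a::complex_star_algebra_1 \<Rightarrow> bool"
  where "selfadjoint a \<longleftrightarrow> star a = a"

lemma clinearI:
  fixes f :: "'a::complex_vector \<Rightarrow> 'b::complex_vector"
  assumes "\<And>x y. f (x + y) = f x + f y" "\<And>c x. f (c *\<^sub>C x) = c *\<^sub>C f x"
  shows "clinear f"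
  by unfold_locales (simp_all add: assms scaleC_add_right scaleC_add_left)

lemma clinear_add: "clinear f \<Longrightarrow> f (x + y) = f x + f y"
  and clinear_scaleC: "clinear f \<Longrightarrow> f (c *\<^sub>C x) = c *\<^sub>C f x"
  by (simp_all add: module_hom.add[OF Vector_Spaces.linear.axioms(3)] module_hom.scale[OF Vector_Spaces.linear.axioms(3)])

lemma clinear_0: "clinear f \<Longrightarrow> f 0 = 0"
  by (metis add_cancel_right_right clinear_add)

lemma clinear_minus: "clinear f \<Longrightarrow> f (- x) = - f x"
  by (metis clinear_0 clinear_add add.right_inverse minus_unique)

lemma clinear_diff: "clinear f \<Longrightarrow> f (x - y) = f x - f y"
  using clinear_add[of f x "- y"] by (simp add: clinear_minus)

lemma clinear_sum: "clinear f \<Longrightarrow> f (\<Sum>i\<in>I. g i) = (\<Sum>i\<in>I. f (g i))"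
  by (induction I rule: infinite_finite_induct) (simp_all add: clinear_0 clinear_add)

lemma cbilinearI:
  assumes "\<And>x x' y. B (x + x') y = B x y + B x' y"
    and "\<And>x y y'. B x (y + y') = B x y + B x y'"
    and "\<And>c x y. B (c *\<^sub>C x) y = c *\<^sub>C B x y"
    and "\<And>c x y. B x (c *\<^sub>C y) = c *\<^sub>C B x y"
  shows "cbilinear B"
  unfolding cbilinear_def by (intro conjI allI clinearI assms)

lemma
  assumes "cbilinear B"
  shows cbilinear_add_left: "B (x + x') y = B x y + B x' y"
    and cbilinear_add_right: "B x (y + y') = B x y + B x y'"
    and cbilinear_scaleC_left: "B (c *\<^sub>C x) y = c *\<^sub>C B x y"
    and cbilinear_scaleC_right: "B x (c *\<^sub>C y) = c *\<^sub>C B x y"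
proof -
  have 1: "clinear (B x)" and 2: "clinear (\<lambda>x. B x y)" for x y
    using assms by (auto simp: cbilinear_def)
  show "B (x + x') y = B x y + B x' y" "B (c *\<^sub>C x) y = c *\<^sub>C B x y"
    using clinear_add[OF 2] clinear_scaleC[OF 2] by auto
  show "B x (y + y') = B x y + B x y'" "B x (c *\<^sub>C y) = c *\<^sub>C B x y"
    using clinear_add[OF 1] clinear_scaleC[OF 1] by auto
qed

instantiation complex :: complex_algebra_1
begin
definition scaleC_complex_def [simp]: "c *\<^sub>C (z :: complex) = c * z"
instance by standard (simp_all add: algebra_simps)
end

instantiation poly :: (complex_vector) complex_vector
begin
definition "c *\<^sub>C p = map_poly (scaleC c) p"
instance
  by standard (auto simp: scaleC_poly_def poly_eq_iff coeff_map_poly scaleC_add_right scaleC_add_left)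
end

lemma coeff_scaleC [simp]: "coeff (c *\<^sub>C p) n = c *\<^sub>C coeff p n"
  by (simp add: scaleC_poly_def coeff_map_poly)

lemma scaleC_eq_smult: "c *\<^sub>C (p :: complex poly) = smult c p"
  by (simp add: poly_eq_iff)

instance poly :: ("{comm_ring_1, complex_algebra_1}") complex_algebra_1
  by standard
    (auto simp: poly_eq_iff coeff_mult complex_vector.scale_sum_right)

instantiation poly_mapping :: (type, complex_vector) complex_vector
begin
definition "c *\<^sub>C f = Poly_Mapping.map (scaleC c) f"

lemma lookup_scaleC_raw: "Poly_Mapping.lookup (c *\<^sub>C f) k = c *\<^sub>C Poly_Mapping.lookup f k"
  for f :: "'a \<Rightarrow>\<^sub>0 'b"
  by (simp add: scaleC_poly_mapping_def map.rep_eq when_def)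

instance
  by standard (simp_all add: poly_mapping_eq_iff fun_eq_iff lookup_scaleC_raw
      lookup_add scaleC_add_right scaleC_add_left)

end

lemma lookup_scaleC [simp]: "Poly_Mapping.lookup (c *\<^sub>C f) k = c *\<^sub>C Poly_Mapping.lookup f k"
  by (rule lookup_scaleC_raw)


section \<open>The algebraic tensor product over the complex numbers\<close>

text \<open>The usual construction: the free vector space on all pairs, modulo the span of the
  bilinearity relations.\<close>

abbreviation free_pair :: "'a \<Rightarrow> 'b \<Rightarrow> ('a \<times> 'b) \<Rightarrow>\<^sub>0 complex"
  where "free_pair x y \<equiv> Poly_Mapping.single (x, y) 1"

definition tensor_relators :: "(('a::complex_vector \<times> 'b::complex_vector) \<Rightarrow>\<^sub>0 complex) set"
  where "tensor_relators =
     {free_pair (x + x') y - free_pair x y - free_pair x' y | x x' y. True}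
   \<union> {free_pair x (y + y') - free_pair x y - free_pair x y' | x y y'. True}
   \<union> {free_pair (c *\<^sub>C x) y - c *\<^sub>C free_pair x y | c x y. True}
   \<union> {free_pair x (c *\<^sub>C y) - c *\<^sub>C free_pair x y | c x y. True}"

definition tensor_rel ::
    "(('a::complex_vector \<times> 'b::complex_vector) \<Rightarrow>\<^sub>0 complex) \<Rightarrow> (('a \<times> 'b) \<Rightarrow>\<^sub>0 complex) \<Rightarrow> bool"
  where "tensor_rel f g \<longleftrightarrow> f - g \<in> cspan tensor_relators"

lemma tensor_rel_add:
  "tensor_rel f f' \<Longrightarrow> tensor_rel g g' \<Longrightarrow> tensor_rel (f + g) (f' + g')"
  unfolding tensor_rel_def by (metis add_diff_add complex_vector.span_add)

lemma tensor_rel_scaleC: "tensor_rel f f' \<Longrightarrow> tensor_rel (c *\<^sub>C f) (c *\<^sub>C f')"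
  unfolding tensor_rel_def
  by (metis complex_vector.scale_right_diff_distrib complex_vector.span_scale)

lemma tensor_rel_refl: "tensor_rel f f"
  by (simp add: tensor_rel_def complex_vector.span_zero)

lemma tensor_rel_uminus: "tensor_rel f f' \<Longrightarrow> tensor_rel (- f) (- f')"
  using tensor_rel_scaleC[of f f' "-1"] by simp

lemma tensor_rel_sym: "tensor_rel f g \<Longrightarrow> tensor_rel g f"
  unfolding tensor_rel_def by (metis complex_vector.span_neg minus_diff_eq)

lemma tensor_rel_trans: "tensor_rel f g \<Longrightarrow> tensor_rel g h \<Longrightarrow> tensor_rel f h"
  unfolding tensor_rel_def
  using complex_vector.span_add[of "f - g" tensor_relators "g - h"] by simp

quotient_type (overloaded) ('a, 'b) tensor =
    "('a::complex_vector \<times> 'b::complex_vector) \<Rightarrow>\<^sub>0 complex" / tensor_rel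
  by (intro equivpI reflpI sympI transpI)
    (auto intro: tensor_rel_refl tensor_rel_sym tensor_rel_trans)

instantiation tensor :: (complex_vector, complex_vector) complex_vector
begin

lift_definition zero_tensor :: "('a, 'b) tensor" is 0 .
lift_definition plus_tensor :: "('a, 'b) tensor \<Rightarrow> ('a, 'b) tensor \<Rightarrow> ('a, 'b) tensor"
  is "(+)" by (rule tensor_rel_add)
lift_definition uminus_tensor :: "('a, 'b) tensor \<Rightarrow> ('a, 'b) tensor"
  is uminus by (rule tensor_rel_uminus)
lift_definition minus_tensor :: "('a, 'b) tensor \<Rightarrow> ('a, 'b) tensor \<Rightarrow> ('a, 'b) tensor"
  is "(-)" by (metis tensor_rel_add tensor_rel_uminus diff_conv_add_uminus)
lift_definition scaleC_tensor :: "complex \<Rightarrow> ('a, 'b) tensor \<Rightarrow> ('a, 'b) tensor"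
  is scaleC by (rule tensor_rel_scaleC)

instance
  by standard
    (transfer; simp add: algebra_simps scaleC_add_right scaleC_add_left tensor_rel_refl)+

end

lift_definition pure_tensor ::
    "'a::complex_vector \<Rightarrow> 'b::complex_vector \<Rightarrow> ('a, 'b) tensor"  (infixr "\<otimes>" 72)
  is free_pair .

definition free_eval ::
    "('a \<Rightarrow> 'b \<Rightarrow> 'c::complex_vector) \<Rightarrow> (('a \<times> 'b) \<Rightarrow>\<^sub>0 complex) \<Rightarrow> 'c"
  where "free_eval B f =
    (\<Sum>k\<in>Poly_Mapping.keys f. Poly_Mapping.lookup f k *\<^sub>C B (fst k) (snd k))"

lemma free_eval_superset:
  assumes "finite S" "Poly_Mapping.keys f \<subseteq> S"
  shows "free_eval B f = (\<Sum>k\<in>S. Poly_Mapping.lookup f k *\<^sub>C B (fst k) (snd k))"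
  unfolding free_eval_def using assms
  by (intro sum.mono_neutral_left) (auto simp: in_keys_iff)

lemma clinear_free_eval: "clinear (free_eval B)"
proof (rule clinearI)
  fix f g :: "('a \<times> 'b) \<Rightarrow>\<^sub>0 complex" and c
  let ?S = "Poly_Mapping.keys f \<union> Poly_Mapping.keys g"
  have "Poly_Mapping.keys (f + g) \<subseteq> ?S" by (rule keys_add)
  then show "free_eval B (f + g) = free_eval B f + free_eval B g"
    by (simp add: free_eval_superset[of ?S] lookup_add scaleC_add_left sum.distrib)
  have "Poly_Mapping.keys (c *\<^sub>C f) \<subseteq> Poly_Mapping.keys f"
    by (auto simp: in_keys_iff)
  then show "free_eval B (c *\<^sub>C f) = c *\<^sub>C free_eval B f"
    by (simp add: free_eval_superset[of "Poly_Mapping.keys f"] complex_vector.scale_sum_right)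
qed

lemma free_eval_free_pair [simp]: "free_eval B (free_pair x y) = B x y"
  by (simp add: free_eval_def)

lemma free_eval_relators:
  assumes "cbilinear B" "f \<in> cspan tensor_relators"
  shows "free_eval B f = 0"
  using assms(2)
proof (induction rule: complex_vector.span_induct_alt)
  case base
  then show ?case by (rule clinear_0[OF clinear_free_eval])
next
  case (step c x y)
  note lin = clinear_add[OF clinear_free_eval] clinear_diff[OF clinear_free_eval]
    clinear_scaleC[OF clinear_free_eval]
  have "free_eval B x = 0"
    using step.hyps(1)
    by (auto simp: tensor_relators_def lin cbilinear_add_left[OF assms(1)]
        cbilinear_add_right[OF assms(1)] cbilinear_scaleC_left[OF assms(1)]
        cbilinear_scaleC_right[OF assms(1)])
  with step show ?case by (simp add: lin)
qed

lemma free_eval_cong: "cbilinear B \<Longrightarrow> tensor_rel f g \<Longrightarrow> free_eval B f = free_eval B g"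
  using free_eval_relators[of B "f - g"]
  by (simp add: tensor_rel_def clinear_diff[OF clinear_free_eval])

text \<open>The linear map induced by a bilinear map \<open>B\<close>; the value \<open>0\<close> is a dummy for other \<open>B\<close>.\<close>

lift_definition tensor_lift ::
    "('a::complex_vector \<Rightarrow> 'b::complex_vector \<Rightarrow> 'c::complex_vector) \<Rightarrow> ('a, 'b) tensor \<Rightarrow> 'c"
  is "\<lambda>B f. if cbilinear B then free_eval B f else 0"
  by (simp add: free_eval_cong)

lemma clinear_tensor_lift: "clinear (tensor_lift B)"
proof (rule clinearI)
  show "tensor_lift B (x + y) = tensor_lift B x + tensor_lift B y" for x y
    by transfer (simp add: clinear_add[OF clinear_free_eval])
  show "tensor_lift B (c *\<^sub>C x) = c *\<^sub>C tensor_lift B x" for c x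
    by transfer (simp add: clinear_scaleC[OF clinear_free_eval])
qed

lemma tensor_lift_pure: "cbilinear B \<Longrightarrow> tensor_lift B (x \<otimes> y) = B x y"
  by transfer simp

lemma cbilinear_pure_tensor: "cbilinear (\<otimes>)"
proof (rule cbilinearI; transfer)
  fix x x' :: 'a and y y' :: 'b and c
  note span = complex_vector.span_base[of _ tensor_relators]
  have "free_pair (x + x') y - free_pair x y - free_pair x' y \<in> cspan tensor_relators"
    by (rule span) (unfold tensor_relators_def, blast)
  then show "tensor_rel (free_pair (x + x') y) (free_pair x y + free_pair x' y)"
    by (simp add: tensor_rel_def diff_diff_eq)
  have "free_pair x (y + y') - free_pair x y - free_pair x y' \<in> cspan tensor_relators"
    by (rule span) (unfold tensor_relators_def, blast)
  then show "tensor_rel (free_pair x (y + y')) (free_pair x y + free_pair x y')"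
    by (simp add: tensor_rel_def diff_diff_eq)
  show "tensor_rel (free_pair (c *\<^sub>C x) y) (c *\<^sub>C free_pair x y)"
    unfolding tensor_rel_def by (rule span) (unfold tensor_relators_def, blast)
  show "tensor_rel (free_pair x (c *\<^sub>C y)) (c *\<^sub>C free_pair x y)"
    unfolding tensor_rel_def by (rule span) (unfold tensor_relators_def, blast)
qed

lemmas pure_tensor_linear =
  cbilinear_add_left[OF cbilinear_pure_tensor] cbilinear_add_right[OF cbilinear_pure_tensor]
  cbilinear_scaleC_left[OF cbilinear_pure_tensor] cbilinear_scaleC_right[OF cbilinear_pure_tensor]

lemma tensor_induct [case_names pure add, induct type: tensor]:
  assumes pure: "\<And>x y. P (x \<otimes> y)"
    and add: "\<And>s t. P s \<Longrightarrow> P t \<Longrightarrow> P (s + t)"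
  shows "P t"
proof -
  have single: "P (abs_tensor (Poly_Mapping.single k c))" for k c
  proof -
    obtain x y where k: "k = (x, y)" by fastforce
    have "free_pair (c *\<^sub>C x) y - c *\<^sub>C free_pair x y \<in> cspan tensor_relators"
      by (rule complex_vector.span_base) (unfold tensor_relators_def, blast)
    moreover have "c *\<^sub>C free_pair x y = Poly_Mapping.single k c"
      by (rule poly_mapping_eqI) (simp add: k lookup_single when_def)
    ultimately have "tensor_rel (free_pair (c *\<^sub>C x) y) (Poly_Mapping.single k c)"
      by (simp add: tensor_rel_def)
    then show ?thesis
      using pure by (metis pure_tensor.abs_eq tensor.abs_eq_iff)
  qed
  have split: "Poly_Mapping.update k c g = Poly_Mapping.single k c + g"
    if "k \<notin> Poly_Mapping.keys g" for k c and g :: "('a \<times> 'b) \<Rightarrow>\<^sub>0 complex"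
    using that
    by (intro poly_mapping_eqI) (auto simp: lookup_update lookup_add lookup_single in_keys_iff)
  have "P (abs_tensor f)" for f
  proof (induction f rule: update_induct)
    case const
    then show ?case using single[of undefined 0] by simp
  next
    case (update f a b)
    then show ?case by (simp add: split plus_tensor.abs_eq[symmetric] single add)
  qed
  then show "P t" by (induction t rule: tensor.abs_induct)
qed

lemma clinear_tensor_eqI:
  assumes "clinear f" "clinear g" "\<And>x y. f (x \<otimes> y) = g (x \<otimes> y)"
  shows "f t = g t"
  by (induction t) (simp_all add: assms(3) clinear_add[OF assms(1)] clinear_add[OF assms(2)])

definition tensor_map ::
    "('a::complex_vector \<Rightarrow> 'c::complex_vector) \<Rightarrow> ('b::complex_vector \<Rightarrow> 'd::complex_vector)
      \<Rightarrow> ('a, 'b) tensor \<Rightarrow> ('c, 'd) tensor"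
  where "tensor_map f g = tensor_lift (\<lambda>x y. f x \<otimes> g y)"

lemma tensor_map_pure:
  "clinear f \<Longrightarrow> clinear g \<Longrightarrow> tensor_map f g (x \<otimes> y) = f x \<otimes> g y"
  unfolding tensor_map_def
  by (rule tensor_lift_pure, rule cbilinearI)
    (simp_all add: clinear_add clinear_scaleC pure_tensor_linear)

text \<open>For functionals, the identifications \<open>\<complex> \<otimes> \<complex> = \<complex>\<close> and \<open>\<complex> \<otimes> V = V\<close> are built in.\<close>

definition functional_tensor ::
    "('a::complex_vector \<Rightarrow> complex) \<Rightarrow> ('b::complex_vector \<Rightarrow> complex) \<Rightarrow> ('a, 'b) tensor \<Rightarrow> complex"
  where "functional_tensor \<phi> \<psi> = tensor_lift (\<lambda>x y. \<phi> x * \<psi> y)"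

definition functional_tensor_id ::
    "('a::complex_vector \<Rightarrow> complex) \<Rightarrow> ('a, 'b::complex_vector) tensor \<Rightarrow> 'b"
  where "functional_tensor_id \<phi> = tensor_lift (\<lambda>x y. \<phi> x *\<^sub>C y)"

lemma functional_tensor_pure:
  "clinear \<phi> \<Longrightarrow> clinear \<psi> \<Longrightarrow> functional_tensor \<phi> \<psi> (x \<otimes> y) = \<phi> x * \<psi> y"
  unfolding functional_tensor_def
  by (rule tensor_lift_pure, rule cbilinearI)
    (simp_all add: clinear_add clinear_scaleC algebra_simps)

lemma functional_tensor_id_pure:
  "clinear \<phi> \<Longrightarrow> functional_tensor_id \<phi> (x \<otimes> y) = \<phi> x *\<^sub>C y"
  unfolding functional_tensor_id_def
  by (rule tensor_lift_pure, rule cbilinearI)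
    (simp_all add: clinear_add clinear_scaleC scaleC_add_left scaleC_add_right mult.commute)

instantiation tensor :: (complex_algebra_1, complex_algebra_1) "{complex_algebra, monoid_mult}"
begin

definition one_tensor :: "('a, 'b) tensor" where "1 = 1 \<otimes> 1"

definition times_tensor :: "('a, 'b) tensor \<Rightarrow> ('a, 'b) tensor \<Rightarrow> ('a, 'b) tensor"
  where "s * t = tensor_lift (\<lambda>f g. tensor_lift (\<lambda>f' g'. (f * f') \<otimes> (g * g')) t) s"

lemma tensor_mult_aux_pure:
  fixes f h :: 'a and g k :: 'b
  shows "tensor_lift (\<lambda>f' g'. (f * f') \<otimes> (g * g')) (h \<otimes> k) = (f * h) \<otimes> (g * k)"
  by (rule tensor_lift_pure, rule cbilinearI) (simp_all add: pure_tensor_linear distrib_left)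

lemma cbilinear_tensor_mult_aux:
  fixes t :: "('a, 'b) tensor"
  shows "cbilinear (\<lambda>f g. tensor_lift (\<lambda>f' g'. (f * f') \<otimes> (g * g')) t)"
  by (rule cbilinearI; induction t;
      simp only: tensor_mult_aux_pure clinear_add[OF clinear_tensor_lift];
      simp add: pure_tensor_linear distrib_right scaleC_add_right)

lemma tensor_mult_pure_raw: "((f :: 'a) \<otimes> (g :: 'b)) * (f' \<otimes> g') = (f * f') \<otimes> (g * g')"
  unfolding times_tensor_def
  by (subst tensor_lift_pure[OF cbilinear_tensor_mult_aux]) (rule tensor_mult_aux_pure)

instance
proof
  fix r s t :: "('a, 'b) tensor" and c
  have add_left: "(s + s') * t = s * t + s' * t" for s s' t :: "('a, 'b) tensor"
    unfolding times_tensor_def by (rule clinear_add[OF clinear_tensor_lift])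
  have scale_left: "(c *\<^sub>C s) * t = c *\<^sub>C (s * t)" for s t :: "('a, 'b) tensor"
    unfolding times_tensor_def by (rule clinear_scaleC[OF clinear_tensor_lift])
  have pure_left: "(f \<otimes> g) * t = tensor_lift (\<lambda>f' g'. (f * f') \<otimes> (g * g')) t"
    for f g and t :: "('a, 'b) tensor"
    unfolding times_tensor_def by (rule tensor_lift_pure[OF cbilinear_tensor_mult_aux])
  have add_right: "s * (t + t') = s * t + s * t'" for s t t' :: "('a, 'b) tensor"
    by (induction s) (simp_all add: pure_left add_left clinear_add[OF clinear_tensor_lift])
  have scale_right: "s * (c *\<^sub>C t) = c *\<^sub>C (s * t)" for s t :: "('a, 'b) tensor"
    by (induction s)
      (simp_all add: pure_left add_left clinear_scaleC[OF clinear_tensor_lift] scaleC_add_right)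
  show "(r + s) * t = r * t + s * t" by (rule add_left)
  show "r * (s + t) = r * s + r * t" by (rule add_right)
  show "(c *\<^sub>C s) * t = c *\<^sub>C (s * t)" by (rule scale_left)
  show "s * (c *\<^sub>C t) = c *\<^sub>C (s * t)" by (rule scale_right)
  have ppp: "((f \<otimes> g) * (f' \<otimes> g')) * t = (f \<otimes> g) * ((f' \<otimes> g') * t)" for f f' g g'
    by (induction t) (simp_all add: tensor_mult_pure_raw add_right mult.assoc)
  have pp: "((f \<otimes> g) * s) * t = (f \<otimes> g) * (s * t)" for f g
    by (induction s) (simp_all add: ppp add_right add_left)
  show "(r * s) * t = r * (s * t)"
    by (induction r) (simp_all add: pp add_left)
  show "1 * t = t"
    by (induction t) (simp_all add: one_tensor_def tensor_mult_pure_raw add_right)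
  show "t * 1 = t"
    by (induction t) (simp_all add: one_tensor_def tensor_mult_pure_raw add_left)
qed

end

lemma tensor_mult_pure:
  fixes f f' :: "'a::complex_algebra_1" and g g' :: "'b::complex_algebra_1"
  shows "(f \<otimes> g) * (f' \<otimes> g') = (f * f') \<otimes> (g * g')"
  by (rule tensor_mult_pure_raw)


section \<open>Polynomials in one variable and the non-commutative derivative\<close>

text \<open>In a single variable the non-commutative polynomials are the ordinary ones, so
  \<open>\<complex>\<langle>x\<rangle>\<close> is the type of complex polynomials.\<close>

definition peval :: "complex poly \<Rightarrow> 'a::complex_algebra_1 \<Rightarrow> 'a"
  where "peval p a = (\<Sum>n\<le>degree p. coeff p n *\<^sub>C a ^ n)"

definition nc_deriv :: "complex poly \<Rightarrow> (complex poly, complex poly) tensor"  ("\<partial>")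
  where "\<partial> p =
    (\<Sum>n\<le>degree p. coeff p n *\<^sub>C (\<Sum>k<n. monom 1 k \<otimes> monom 1 (n - k - 1)))"

lemma clinear_coeff_sum:
  fixes F :: "nat \<Rightarrow> 'a::complex_vector"
  shows "clinear (\<lambda>p :: complex poly. \<Sum>n\<le>degree p. coeff p n *\<^sub>C F n)"
proof -
  have ext: "(\<Sum>n\<le>degree p. coeff p n *\<^sub>C F n) = (\<Sum>n\<le>N. coeff p n *\<^sub>C F n)"
    if "degree p \<le> N" for p :: "complex poly" and N
    using that by (intro sum.mono_neutral_left) (auto simp: coeff_eq_0)
  show ?thesis
  proof (rule clinearI)
    fix p q :: "complex poly" and c
    let ?N = "max (degree p) (degree q)"
    show "(\<Sum>n\<le>degree (p + q). coeff (p + q) n *\<^sub>C F n)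
        = (\<Sum>n\<le>degree p. coeff p n *\<^sub>C F n) + (\<Sum>n\<le>degree q. coeff q n *\<^sub>C F n)"
      unfolding ext[OF degree_add_le_max[of p q]] ext[of p ?N, OF max.cobounded1]
        ext[of q ?N, OF max.cobounded2]
      by (simp add: scaleC_add_left sum.distrib)
    have "degree (c *\<^sub>C p) \<le> degree p"
      by (simp add: scaleC_eq_smult degree_smult_le)
    from ext[OF this] show "(\<Sum>n\<le>degree (c *\<^sub>C p). coeff (c *\<^sub>C p) n *\<^sub>C F n)
        = c *\<^sub>C (\<Sum>n\<le>degree p. coeff p n *\<^sub>C F n)"
      by (simp add: complex_vector.scale_sum_right)
  qed
qed

lemma coeff_sum_monom:
  fixes F :: "nat \<Rightarrow> 'a::complex_vector"
  shows "(\<Sum>n\<le>degree (monom (1::complex) m). coeff (monom 1 m) n *\<^sub>C F n) = F m"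
  by (simp add: degree_monom_eq if_distrib[of "\<lambda>c. c *\<^sub>C _"] cong: if_cong)

lemma clinear_nc_deriv: "clinear \<partial>"
  unfolding nc_deriv_def by (rule clinear_coeff_sum)

lemma nc_deriv_monom: "\<partial> (monom 1 n) = (\<Sum>k<n. monom 1 k \<otimes> monom 1 (n - k - 1))"
  unfolding nc_deriv_def by (rule coeff_sum_monom)

lemma clinear_peval: "clinear (\<lambda>p. peval p a)"
  unfolding peval_def by (rule clinear_coeff_sum)

lemma peval_monom: "peval (monom 1 n) a = a ^ n"
  unfolding peval_def by (rule coeff_sum_monom)

definition nc_deriv_at :: "complex poly \<Rightarrow> 'a::complex_algebra_1 \<Rightarrow> ('a, 'a) tensor"
  where "nc_deriv_at p a = tensor_map (\<lambda>f. peval f a) (\<lambda>g. peval g a) (\<partial> p)"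


section \<open>Non-commutative probability spaces\<close>

locale nc_probability_space =
  fixes \<phi> :: "'a::complex_algebra_1 \<Rightarrow> complex"
  assumes clinear_state: "clinear \<phi>"
    and state_one: "\<phi> 1 = 1"

definition kappa2 :: "('a::complex_algebra_1 \<Rightarrow> complex) \<Rightarrow> 'a \<Rightarrow> 'a \<Rightarrow> complex"
  where "kappa2 \<phi> b c = \<phi> (b * c) - \<phi> b * \<phi> c"

definition conjugate_variable :: "('a::complex_algebra_1 \<Rightarrow> complex) \<Rightarrow> 'a \<Rightarrow> 'a \<Rightarrow> bool"
  where "conjugate_variable \<phi> a \<xi> \<longleftrightarrow>
    (\<forall>p. \<phi> (\<xi> * peval p a) = functional_tensor \<phi> \<phi> (nc_deriv_at p a))"

definition phi1 :: "('a::complex_algebra_1 \<Rightarrow> complex) \<Rightarrow> 'a \<Rightarrow> complex poly \<Rightarrow> complex"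
  where "phi1 \<phi> a p = \<phi> (peval p a)"

definition phi2 ::
    "('a::complex_algebra_1 \<Rightarrow> complex) \<Rightarrow> 'a \<Rightarrow> complex poly \<Rightarrow> complex poly \<Rightarrow> complex"
  where "phi2 \<phi> a p q = kappa2 \<phi> (peval p a) (peval q a)"

text \<open>\<open>phi2_conj \<phi> a \<xi> p q\<close> stands for \<open>\<phi>\<^sub>2(\<xi> p(x), q(x))\<close>, where the first argument is a
  polynomial multiplied from the left by \<open>\<xi>\<close>.\<close>

definition phi2_conj ::
    "('a::complex_algebra_1 \<Rightarrow> complex) \<Rightarrow> 'a \<Rightarrow> 'a \<Rightarrow> complex poly \<Rightarrow> complex poly \<Rightarrow> complex"
  where "phi2_conj \<phi> a \<xi> p q = kappa2 \<phi> (\<xi> * peval p a) (peval q a)"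

end

theory Submission
  imports Defs
begin

text \<open>Since \<open>\<xi> p(a) q(a) = \<xi> (pq)(a)\<close>, the conjugate variable relation turns the first term of the
  cumulant into \<open>(\<phi>\<^sub>1 \<otimes> \<phi>\<^sub>1)(\<partial>(pq))\<close>.  The Leibniz rule
  \<open>\<partial>(pq) = \<partial>p \<cdot> (1 \<otimes> q) + (p \<otimes> 1) \<cdot> \<partial>q\<close> splits it into the last term of the claim and
  \<open>\<phi>(r(a) q(a))\<close> with \<open>r = (\<phi>\<^sub>1 \<otimes> id)(\<partial>p)\<close>, while \<open>\<phi>(\<xi> p(a)) = \<phi>(r(a))\<close>.\<close>

lemma clinear_comp: "clinear f \<Longrightarrow> clinear g \<Longrightarrow> clinear (\<lambda>x. g (f x))"
  by (rule clinearI) (simp_all add: clinear_add clinear_scaleC)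

lemma clinear_plus: "clinear f \<Longrightarrow> clinear g \<Longrightarrow> clinear (\<lambda>x. f x + g x)"
  by (rule clinearI) (simp_all add: clinear_add clinear_scaleC scaleC_add_right)

lemma clinear_mult_left: "clinear (\<lambda>x::'a::complex_algebra. c * x)"
  and clinear_mult_right: "clinear (\<lambda>x::'a::complex_algebra. x * c)"
  by (rule clinearI; simp add: distrib_left distrib_right)+

lemma clinear_pure_tensor_left: "clinear (\<lambda>x. x \<otimes> y)"
  and clinear_pure_tensor_right: "clinear (\<lambda>y. x \<otimes> y)"
  by (rule clinearI; simp add: pure_tensor_linear)+

text \<open>Monomials span the polynomials, so two linear maps that agree on them coincide. Applied
  to each argument in turn, this reduces bilinear identities to pairs of monomials.\<close>

lemma clinear_poly_eqI:
  fixes f g :: "complex poly \<Rightarrow> 'b::complex_vector"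
  assumes "clinear f" "clinear g" "\<And>n. f (monom 1 n) = g (monom 1 n)"
  shows "f p = g p"
proof -
  have p: "p = (\<Sum>n\<le>degree p. coeff p n *\<^sub>C monom 1 n)"
    by (simp add: scaleC_eq_smult smult_monom poly_as_sum_of_monoms)
  show ?thesis
    \<comment> \<open>The equation \<open>p\<close> has \<open>p\<close> on its right side too, so
      it is applied only once, to the arguments of \<open>f\<close> and \<open>g\<close>.\<close>
    by (subst (1 2) p) (simp only: clinear_sum[OF assms(1)] clinear_sum[OF assms(2)]
        clinear_scaleC[OF assms(1)] clinear_scaleC[OF assms(2)] assms(3))
qed

lemma peval_mult: "peval (p * q) a = peval p a * peval q a"
proof (rule clinear_poly_eqI[where p = p])
  show "clinear (\<lambda>p. peval (p * q) a)"
    by (rule clinear_comp[OF clinear_mult_right clinear_peval])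
  show "clinear (\<lambda>p. peval p a * peval q a)"
    by (rule clinear_comp[OF clinear_peval clinear_mult_right])
  fix m
  show "peval (monom 1 m * q) a = peval (monom 1 m) a * peval q a"
  proof (rule clinear_poly_eqI[where p = q])
    show "clinear (\<lambda>q. peval (monom 1 m * q) a)"
      by (rule clinear_comp[OF clinear_mult_left clinear_peval])
    show "clinear (\<lambda>q. peval (monom 1 m) a * peval q a)"
      by (rule clinear_comp[OF clinear_peval clinear_mult_left])
  qed (simp add: mult_monom peval_monom power_add)
qed

text \<open>The sum for degree \<open>m + n\<close> is cut at index \<open>m\<close>. Below the cut
  the right leg still contains the full power \<open>n\<close>, which splits off on the right; from
  the cut on, the left leg contains the full power \<open>m\<close>.\<close>

lemma nc_deriv_mult_monom:
  "\<partial> (monom 1 m * monom 1 n) =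
    \<partial> (monom 1 m) * (1 \<otimes> monom 1 n) + (monom 1 m \<otimes> 1) * \<partial> (monom 1 n)"
proof -
  have split: "(\<Sum>k<m + n. F k) = (\<Sum>k<m. F k) + (\<Sum>k<n. F (m + k))"
    for F :: "nat \<Rightarrow> (complex poly, complex poly) tensor"
    by (induction n) (simp_all add: add.assoc)
  \<comment> \<open>The bound \<open>k < m\<close> makes the truncated subtraction harmless:
    \<open>m + n - k - 1 = (m - k - 1) + n\<close>.\<close>
  have "(\<Sum>k<m. monom (1::complex) k \<otimes> monom (1::complex) (m + n - k - 1)) =
      \<partial> (monom 1 m) * (1 \<otimes> monom 1 n)"
    unfolding nc_deriv_monom sum_distrib_right
    by (rule sum.cong) (simp_all add: tensor_mult_pure mult_monom)
  moreover have "(\<Sum>k<n. monom (1::complex) (m + k) \<otimes> monom (1::complex) (m + n - (m + k) - 1)) =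
      (monom 1 m \<otimes> 1) * \<partial> (monom 1 n)"
    unfolding nc_deriv_monom sum_distrib_left
    by (rule sum.cong) (simp_all add: tensor_mult_pure mult_monom)
  ultimately show ?thesis
    by (simp only: mult_monom mult_1 nc_deriv_monom[of "m + n"] split)
qed

lemma nc_deriv_mult: "\<partial> (p * q) = \<partial> p * (1 \<otimes> q) + (p \<otimes> 1) * \<partial> q"
proof (rule clinear_poly_eqI[where p = p])
  show "clinear (\<lambda>p. \<partial> (p * q))"
    by (rule clinear_comp[OF clinear_mult_right clinear_nc_deriv])
  show "clinear (\<lambda>p. \<partial> p * (1 \<otimes> q) + (p \<otimes> 1) * \<partial> q)"
    by (rule clinear_plus[OF clinear_comp[OF clinear_nc_deriv clinear_mult_right]
          clinear_comp[OF clinear_pure_tensor_left clinear_mult_right]])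
  fix m
  show "\<partial> (monom 1 m * q) = \<partial> (monom 1 m) * (1 \<otimes> q) + (monom 1 m \<otimes> 1) * \<partial> q"
  proof (rule clinear_poly_eqI[where p = q])
    show "clinear (\<lambda>q. \<partial> (monom 1 m * q))"
      by (rule clinear_comp[OF clinear_mult_left clinear_nc_deriv])
    show "clinear (\<lambda>q. \<partial> (monom 1 m) * (1 \<otimes> q) + (monom 1 m \<otimes> 1) * \<partial> q)"
      by (rule clinear_plus[OF clinear_comp[OF clinear_pure_tensor_right clinear_mult_left]
            clinear_comp[OF clinear_nc_deriv clinear_mult_left]])
  qed (rule nc_deriv_mult_monom)
qed

lemma clinear_functional_tensor: "clinear (functional_tensor \<phi> \<psi>)"
  unfolding functional_tensor_def by (rule clinear_tensor_lift)

lemma clinear_functional_tensor_id: "clinear (functional_tensor_id \<phi>)"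
  unfolding functional_tensor_id_def by (rule clinear_tensor_lift)

lemma clinear_tensor_map: "clinear (tensor_map f g)"
  unfolding tensor_map_def by (rule clinear_tensor_lift)

text \<open>Moves the substitution of \<open>a\<close> from the tensor into the functionals, so that
  the conjugate variable relation can be read on polynomials.\<close>

lemma functional_tensor_map:
  assumes "clinear f" "clinear g" "clinear \<phi>" "clinear \<psi>"
  shows "functional_tensor \<phi> \<psi> (tensor_map f g t) =
    functional_tensor (\<lambda>x. \<phi> (f x)) (\<lambda>y. \<psi> (g y)) t"
  by (rule clinear_tensor_eqI[where t = t])
    (simp_all add: clinear_comp[OF clinear_tensor_map clinear_functional_tensor]
      clinear_functional_tensor tensor_map_pure functional_tensor_pure assms clinear_comp)

text \<open>The legs can be evaluated one after the other, since \<psi> is linear and the value of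
  \<phi> is a scalar.\<close>

lemma functional_tensor_eq_functional_tensor_id:
  assumes "clinear \<phi>" "clinear \<psi>"
  shows "functional_tensor \<phi> \<psi> t = \<psi> (functional_tensor_id \<phi> t)"
  by (rule clinear_tensor_eqI[where t = t])
    (simp_all add: clinear_functional_tensor clinear_comp[OF clinear_functional_tensor_id assms(2)]
      functional_tensor_pure functional_tensor_id_pure assms clinear_scaleC)

text \<open>The factor \<open>1 \<otimes> y\<close> acts only on the second leg, which \<phi> does
  not touch.\<close>

lemma functional_tensor_id_mult_right:
  assumes "clinear \<phi>"
  shows "functional_tensor_id \<phi> (t * (1 \<otimes> y)) = functional_tensor_id \<phi> t * y"
  by (rule clinear_tensor_eqI[where t = t])
    (simp_all add: clinear_comp[OF clinear_mult_right clinear_functional_tensor_id]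
      clinear_comp[OF clinear_functional_tensor_id clinear_mult_right]
      functional_tensor_id_pure assms tensor_mult_pure)

theorem mainTheorem3:
  fixes \<phi> :: "'a::complex_star_algebra_1 \<Rightarrow> complex"
    and a \<xi> :: 'a
    and p q :: "complex poly"
  assumes "nc_probability_space \<phi>"
    and "selfadjoint a"
    and "conjugate_variable \<phi> a \<xi>"
  shows "phi2_conj \<phi> a \<xi> p q =
      phi2 \<phi> a (functional_tensor_id (phi1 \<phi> a) (\<partial> p)) q
    + functional_tensor (phi1 \<phi> a) (phi1 \<phi> a) ((p \<otimes> 1) * \<partial> q)"
proof -
  let ?\<phi>1 = "phi1 \<phi> a"
  let ?r = "functional_tensor_id ?\<phi>1 (\<partial> p)"
  have lin: "clinear \<phi>"
    using assms(1) by (rule nc_probability_space.clinear_state)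
  have lin1: "clinear ?\<phi>1"
    unfolding phi1_def[abs_def] by (rule clinear_comp[OF clinear_peval lin])
  have conj: "\<phi> (\<xi> * peval f a) = functional_tensor ?\<phi>1 ?\<phi>1 (\<partial> f)" for f
    using assms(3)
    by (simp add: conjugate_variable_def nc_deriv_at_def phi1_def[abs_def]
        functional_tensor_map[OF clinear_peval clinear_peval lin lin])
  have "\<phi> (\<xi> * peval p a * peval q a) = functional_tensor ?\<phi>1 ?\<phi>1 (\<partial> (p * q))"
    by (simp add: conj[symmetric] peval_mult mult.assoc)
  also have "\<dots> = functional_tensor ?\<phi>1 ?\<phi>1 (\<partial> p * (1 \<otimes> q))
      + functional_tensor ?\<phi>1 ?\<phi>1 ((p \<otimes> 1) * \<partial> q)"
    by (simp only: nc_deriv_mult clinear_add[OF clinear_functional_tensor])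
  \<comment> \<open>Evaluating the left leg first turns the derivative of \<open>p\<close> into
    \<open>?r\<close> and lets \<open>q\<close> pass through.\<close>
  also have "functional_tensor ?\<phi>1 ?\<phi>1 (\<partial> p * (1 \<otimes> q)) = ?\<phi>1 (?r * q)"
    by (simp add: functional_tensor_eq_functional_tensor_id functional_tensor_id_mult_right lin1)
  also have "\<dots> = \<phi> (peval ?r a * peval q a)"
    by (simp add: phi1_def peval_mult)
  finally have 1: "\<phi> (\<xi> * peval p a * peval q a) =
    \<phi> (peval ?r a * peval q a) + functional_tensor ?\<phi>1 ?\<phi>1 ((p \<otimes> 1) * \<partial> q)" .
  have "\<phi> (\<xi> * peval p a) = ?\<phi>1 ?r"
    by (simp add: conj functional_tensor_eq_functional_tensor_id lin1)
  then have 2: "\<phi> (\<xi> * peval p a) = \<phi> (peval ?r a)"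
    by (simp only: phi1_def)
  show ?thesis
    \<comment> \<open>By \<open>2\<close>, both cumulants subtract the same product of first
      moments.\<close>
    by (simp add: phi2_conj_def phi2_def kappa2_def 1 2)
qed

end
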